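(* Let $x=\frac{a}{b}$ and $y=\frac{\alpha}{\beta}$ be fractions, i.e. $a,b,\alpha,\beta$ are integers with $b\neq 0$, $\beta\neq 0$, and assume $b+\beta\neq 0$. Then $x+y = x\boxplus y$ if and only if $$b^2\left(a\beta-\alpha+\tfrac12\beta^2\right)+\beta^2\left(\alpha b-a+\tfrac12 b^2\right)+ab\beta(\alpha-1)-\alpha\beta b=0.$$
   Context: The dual addition of second kind $\boxplus$ is defined on given representations of fractions, i.e. in terms of the given numerators and denominators $a,b,\alpha,\beta$, by $$\frac{a}{b}\boxplus\frac{\alpha}{\beta} := \frac{(a+\beta)\cdot(\alpha+b)}{b+\beta}.$$ The result depends in general on the chosen representations. The operation $+$ is the usual addition. *)

theory Defs imports Complex_Main begin

(* The dual addition of second kind depends on the chosen representations, not only on the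
   values of the fractions.  A pair (n, d) is therefore the unreduced fraction n / d; the result
   is returned as a rational number. *)

fun dual_add2 :: "int \<times> int \<Rightarrow> int \<times> int \<Rightarrow> rat" (infixl "\<boxplus>" 65) where
  "(a, b) \<boxplus> (\<alpha>, \<beta>) = of_int ((a + \<beta>) * (\<alpha> + b)) / of_int (b + \<beta>)"

end

theory Submission imports Defs begin

text \<open>Multiplying the equation \<open>x + y = x \<boxplus> y\<close> by the nonzero common denominator
  \<open>b * \<beta> * (b + \<beta>)\<close> gives the equivalent polynomial equation
  \<open>(a * \<beta> + \<alpha> * b) * (b + \<beta>) = b * \<beta> * (a + \<beta>) * (\<alpha> + b)\<close>.
  The stated polynomial is the right-hand side minus the left-hand side of this equation; the two
  halves in it arise from splitting the monomial \<open>b\<^sup>2 * \<beta>\<^sup>2\<close> symmetrically.\<close>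

theorem proposition3:
  fixes a b \<alpha> \<beta> :: int
  assumes "b \<noteq> 0" and "\<beta> \<noteq> 0" and "b + \<beta> \<noteq> 0"
  shows "of_int a / of_int b + of_int \<alpha> / of_int \<beta> = (a, b) \<boxplus> (\<alpha>, \<beta>) \<longleftrightarrow>
    (of_int (b\<^sup>2) :: rat) * (of_int (a * \<beta> - \<alpha>) + 1/2 * of_int (\<beta>\<^sup>2))
      + of_int (\<beta>\<^sup>2) * (of_int (\<alpha> * b - a) + 1/2 * of_int (b\<^sup>2))
      + of_int (a * b * \<beta> * (\<alpha> - 1)) - of_int (\<alpha> * \<beta> * b) = 0"
    (is "?sum = ?dual \<longleftrightarrow> ?P = 0")
proof -
  define A B C D :: rat
    where "A = of_int a" and "B = of_int b" and "C = of_int \<alpha>" and "D = of_int \<beta>"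
  note defs = A_def B_def C_def D_def
  have nz: "B \<noteq> 0" "D \<noteq> 0"
    using assms(1,2) by (simp_all add: defs)
  have nz': "B + D \<noteq> 0"
    using assms(3) unfolding defs by (metis of_int_add of_int_eq_0_iff)
  have "?sum = ?dual \<longleftrightarrow> (A * D + C * B) / (B * D) = (A + D) * (C + B) / (B + D)"
    using nz by (simp add: defs add_frac_eq)
  also have "\<dots> \<longleftrightarrow> (A * D + C * B) * (B + D) = (A + D) * (C + B) * (B * D)"
    using nz nz' by (intro frac_eq_eq) auto
  also have "\<dots> \<longleftrightarrow> (A + D) * (C + B) * (B * D) - (A * D + C * B) * (B + D) = 0"
    by auto
  also have "(A + D) * (C + B) * (B * D) - (A * D + C * B) * (B + D) = ?P"
    by (simp add: defs algebra_simps power2_eq_square)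
  finally show ?thesis .
qed

end
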